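(* There is an absolute constant $C>0$ such that the following holds. Fix $j\in\mathbb N$ and write $\phi=\phi_j$, $\lambda=\lambda_j$, and let $\Phi_0(x)=\int_0^x\phi(y)\,dy$. Then for all $0<x\le1$, $$|\Phi_0(x)|\le C\,|\lambda|^3x^3\min\Big\{\lambda^2,\,1+\log\tfrac1x\Big\}.$$
   Context: Let $K:[0,1]\times[0,1]\to\mathbb R$ be defined by $K(x,y)=\frac12-\{(xy)^{-1}\}$ if $0<x,y\le 1$, and $K(x,y)=0$ if $0\le x,y\le1$ and $xy=0$, where $\{\alpha\}=\alpha-\lfloor\alpha\rfloor$. Let $L^2([0,1])$ denote the space of real-valued Lebesgue measurable square-integrable functions on $[0,1]$, with $\langle f,g\rangle=\int_0^1 f(x)g(x)\,dx$ and $\|f\|=\langle f,f\rangle^{1/2}$. A function $\phi$ is an eigenfunction of $K$ (with eigenvalue $\lambda\in\mathbb R$) if $\phi\in L^2([0,1])$, $\|\phi\|>0$, and $\phi(x)=\lambda\int_0^1 K(x,y)\phi(y)\,dy$ for every $x\in[0,1]$. Let $\phi_1,\phi_2,\ldots$ be a maximal orthonormal system in $L^2([0,1])$ of eigenfunctions of $K$, $\phi_j$ having the nonzero real eigenvalue $\lambda_j$, numbered so that $0<|\lambda_1|\le|\lambda_2|\le\cdots$ and $\lambda_j\ge\lambda_{j+1}$ whenever $|\lambda_j|=|\lambda_{j+1}|$. *)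

theory Defs
  imports "HOL-Analysis.Analysis"
begin

definition K :: "real \<Rightarrow> real \<Rightarrow> real" where
  "K x y = (if x * y = 0 then 0 else 1/2 - frac (1 / (x * y)))"

definition L2 :: "(real \<Rightarrow> real) \<Rightarrow> bool" where
  "L2 f \<longleftrightarrow> f \<in> borel_measurable (lebesgue_on {0..1})
      \<and> integrable (lebesgue_on {0..1}) (\<lambda>x. (f x)^2)"

definition ip :: "(real \<Rightarrow> real) \<Rightarrow> (real \<Rightarrow> real) \<Rightarrow> real" where
  "ip f g = (LINT x|lebesgue_on {0..1}. f x * g x)"

definition L2norm :: "(real \<Rightarrow> real) \<Rightarrow> real" where
  "L2norm f = sqrt (ip f f)"

definition is_eigenfunction :: "(real \<Rightarrow> real) \<Rightarrow> real \<Rightarrow> bool" where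
  "is_eigenfunction phi lam \<longleftrightarrow> L2 phi \<and> L2norm phi > 0
     \<and> (\<forall>x\<in>{0..1}. phi x = lam * (LINT y|lebesgue_on {0..1}. K x y * phi y))"

text \<open>phi 1, phi 2, ... is a maximal orthonormal system of eigenfunctions of K,
  phi j having nonzero eigenvalue lam j, ordered as in the paper.
  (Index 0 is unused.)\<close>
definition eigen_system :: "(nat \<Rightarrow> real \<Rightarrow> real) \<Rightarrow> (nat \<Rightarrow> real) \<Rightarrow> bool" where
  "eigen_system phi lam \<longleftrightarrow>
     (\<forall>j\<ge>1. lam j \<noteq> 0 \<and> is_eigenfunction (phi j) (lam j))
   \<and> (\<forall>i\<ge>1. \<forall>j\<ge>1. ip (phi i) (phi j) = (if i = j then 1 else 0))
   \<and> (\<forall>psi mu. mu \<noteq> 0 \<and> is_eigenfunction psi mu \<and> (\<forall>j\<ge>1. ip psi (phi j) = 0) \<longrightarrow> False)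
   \<and> 0 < \<bar>lam 1\<bar>
   \<and> (\<forall>j\<ge>1. \<bar>lam j\<bar> \<le> \<bar>lam (Suc j)\<bar>)
   \<and> (\<forall>j\<ge>1. \<bar>lam j\<bar> = \<bar>lam (Suc j)\<bar> \<longrightarrow> lam j \<ge> lam (Suc j))"

end

theory Submission
  imports Defs
begin

text \<open>
  Let \<open>saw1 u = 1/2 - frac u\<close> and let \<open>saw2\<close>, \<open>saw3\<close> be its successive periodic primitives of mean
  zero. Integrating by parts twice, \<open>\<integral>\<^sub>0\<^sup>x K t y dt = - x\<^sup>2 y saw2 (1 / (x y)) + O(x\<^sup>3)\<close>, so the eigenvalue
  equation reduces the claim to a bound of order \<open>x\<close> for the moment
  \<open>J = \<integral>\<^sub>0\<^sup>1 y saw2 (1 / (x y)) \<phi> y dy\<close>. Applying the eigenvalue equation once more gives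
  \<open>J = \<mu> \<integral>\<^sub>0\<^sup>1 \<phi> z T z dz\<close> with \<open>T z = \<integral>\<^sub>0\<^sup>1 y saw2 (1 / (x y)) K y z dy\<close>, and the oscillation of \<open>saw2\<close> yields
  \<open>T z = O(min 1 (x / z))\<close>. Together with \<open>\<bar>\<phi>\<bar> \<le> \<bar>\<mu>\<bar>\<close> this gives the logarithmic bound. For the bound
  without logarithm, the same argument applied to the iterated kernel shows
  \<open>\<phi> z = O(\<bar>\<mu>\<bar>\<^sup>3 sqrt z)\<close>, so that \<open>\<phi> z / z\<close> is integrable.
\<close>

section \<open>Periodic sawtooth functions and oscillatory integrals\<close>

definition saw1 :: "real \<Rightarrow> real" where
  "saw1 u = 1/2 - frac u"

text \<open>Up to the factor -1/n!, \<open>saw1\<close>, \<open>saw2\<close> and \<open>saw3\<close>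
  are the Bernoulli polynomials B_1, B_2, B_3 evaluated at \<open>frac u\<close>. The constant -1/12
  gives \<open>saw2\<close> mean zero over a period, which is what makes its primitive
  \<open>saw3\<close> periodic and hence continuous.\<close>

definition saw2 :: "real \<Rightarrow> real" where
  "saw2 u = frac u / 2 - (frac u)^2 / 2 - 1/12"

definition saw3 :: "real \<Rightarrow> real" where
  "saw3 u = (frac u)^2 / 4 - (frac u)^3 / 6 - frac u / 12"

lemma saw2_measurable [measurable]: "saw2 \<in> borel_measurable borel"
  unfolding saw2_def frac_def by measurable

lemma frac_bounds: "0 \<le> frac u" "frac u \<le> 1" for u :: real
  by (auto simp: frac_lt_1 less_imp_le)

lemma abs_saw1_le: "\<bar>saw1 u\<bar> \<le> 1/2"
  using frac_bounds[of u] unfolding saw1_def abs_le_iff by linarith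

lemma abs_saw2_le: "\<bar>saw2 u\<bar> \<le> 1/2"
proof -
  have "0 \<le> (frac u)^2" "(frac u)^2 \<le> frac u"
    using frac_bounds[of u] by (auto simp: power2_eq_square mult_left_le)
  then show ?thesis
    using frac_bounds[of u] unfolding saw2_def abs_le_iff by linarith
qed

lemma abs_saw3_le: "\<bar>saw3 u\<bar> \<le> 1/2"
proof -
  have "0 \<le> (frac u)^2" "(frac u)^2 \<le> 1" "0 \<le> (frac u)^3" "(frac u)^3 \<le> 1"
    using frac_bounds[of u] by (auto simp: power_le_one)
  then show ?thesis
    using frac_bounds[of u] unfolding saw3_def abs_le_iff by linarith
qed

text \<open>On each closed interval from n to n + 1 the function agrees with
  \<open>h (u - of_int n)\<close>, at the right end thanks to \<open>h 0 = h 1\<close>. Two adjacent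
  intervals of this kind form a neighbourhood of any given point.\<close>

lemma continuous_on_frac_glue:
  fixes h :: "real \<Rightarrow> real"
  assumes h: "continuous_on {0..1} h" and glue: "h 0 = h 1"
  shows "continuous_on UNIV (\<lambda>u. h (frac u))"
proof -
  have piece: "continuous_on {of_int n..of_int n + 1} (\<lambda>u. h (frac u))" for n :: int
  proof -
    have "continuous_on {of_int n..of_int n + 1} (\<lambda>u. h (u - of_int n))"
      by (rule continuous_on_compose2[OF h]) (auto intro!: continuous_intros)
    moreover have "h (frac u) = h (u - of_int n)" if "u \<in> {of_int n..of_int n + 1}" for u
    proof (cases "u = of_int n + 1")
      case True
      then have "frac u = 0" by simp
      then show ?thesis using True glue by simp
    next
      case False
      then have "\<lfloor>u\<rfloor> = n" using that by (intro floor_unique) auto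
      then show ?thesis by (simp add: frac_def)
    qed
    ultimately show ?thesis by (subst continuous_on_cong[OF refl]) auto
  qed
  have "isCont (\<lambda>u. h (frac u)) u" for u
  proof -
    define n where "n = \<lfloor>u\<rfloor>"
    have u: "of_int n \<le> u" "u < of_int n + 1" by (auto simp: n_def)
    have "continuous_on ({of_int (n-1)..of_int (n-1) + 1} \<union> {of_int n..of_int n + 1}) (\<lambda>u. h (frac u))"
      by (intro continuous_on_closed_Un piece closed_atLeastAtMost)
    then have "continuous_on {of_int n - 1<..<of_int n + 1} (\<lambda>u. h (frac u))"
      by (rule continuous_on_subset) auto
    then show ?thesis
      using u by (subst (asm) continuous_on_eq_continuous_at) auto
  qed
  then show ?thesis by (simp add: continuous_at_imp_continuous_on)
qed

lemma continuous_on_saw2: "continuous_on UNIV saw2"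
  unfolding saw2_def
  by (rule continuous_on_frac_glue[where h = "\<lambda>t. t / 2 - t^2 / 2 - 1/12"])
     (auto intro!: continuous_intros)

lemma continuous_on_saw3: "continuous_on UNIV saw3"
  unfolding saw3_def
  by (rule continuous_on_frac_glue[where h = "\<lambda>t. t^2 / 4 - t^3 / 6 - t / 12"])
     (auto intro!: continuous_intros)

lemma frac_has_real_derivative:
  "u \<notin> \<int> \<Longrightarrow> (frac has_real_derivative 1) (at u)" for u :: real
  unfolding frac_def[abs_def]
  by (auto intro!: derivative_eq_intros floor_has_real_derivative)

lemma saw2_has_real_derivative:
  "u \<notin> \<int> \<Longrightarrow> (saw2 has_real_derivative saw1 u) (at u)"
  unfolding saw2_def[abs_def] saw1_def
  by (auto intro!: derivative_eq_intros frac_has_real_derivative)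

lemma saw3_has_real_derivative:
  "u \<notin> \<int> \<Longrightarrow> (saw3 has_real_derivative saw2 u) (at u)"
  unfolding saw3_def[abs_def] saw2_def
  by (auto intro!: derivative_eq_intros frac_has_real_derivative simp: power2_eq_square field_simps)

text \<open>Integration by parts: the derivative of \<open>Q (1 / (x * y))\<close> in y is
  \<open>- R (1 / (x * y)) / (x * y\<^sup>2)\<close>, so passing from R to its primitive Q gains a
  factor x. The weight is written \<open>y^m / y\<^sup>2\<close> because the exponent m - 2 is
  negative at m = 1.\<close>

lemma oscillation_has_integral:
  fixes Q R :: "real \<Rightarrow> real"
  assumes Q: "continuous_on UNIV Q"
    and QR: "\<And>u. u \<notin> \<int> \<Longrightarrow> (Q has_real_derivative R u) (at u)"
    and ab: "0 < a" "a \<le> b" and x: "0 < x" and m: "0 < m"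
  shows "((\<lambda>y. y^m / y\<^sup>2 * R (1 / (x * y))) has_integral
      (x * a^m * Q (1 / (x * a)) - x * b^m * Q (1 / (x * b))
        + real m * x * integral {a..b} (\<lambda>y. y^(m-1) * Q (1 / (x * y))))) {a..b}"
proof -
  \<comment> \<open>The derivative of Q is known only off the integers. Since y stays above a > 0,
    only finitely many y make \<open>1 / (x * y)\<close> an integer, and at those points continuity
    suffices for the strong fundamental theorem.\<close>
  define S where "S = {y \<in> {a..b}. 1 / (x * y) \<in> \<int>}"
  let ?F = "\<lambda>y. - x * y^m * Q (1 / (x * y))"
  let ?D = "\<lambda>y. y^m / y\<^sup>2 * R (1 / (x * y)) - real m * x * (y^(m-1) * Q (1 / (x * y)))"
  have "S \<subseteq> (\<lambda>k. 1 / (x * of_int k)) ` {0..\<lceil>1 / (x * a)\<rceil>}"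
  proof
    fix y assume "y \<in> S"
    then obtain k :: int where k: "1 / (x * y) = of_int k" and y: "a \<le> y" "y \<le> b"
      by (auto simp: S_def Ints_def)
    have "y > 0" using y ab by simp
    then have "of_int k \<ge> (0::real)" using k x by (metis divide_nonneg_pos mult_pos_pos zero_le_one)
    then have "0 \<le> k" by simp
    have "1 / (x * y) \<le> 1 / (x * a)"
      using x y ab by (intro divide_left_mono mult_left_mono mult_pos_pos) auto
    then have "k \<le> \<lceil>1 / (x * a)\<rceil>" using k by (metis ceiling_mono ceiling_of_int)
    moreover have "y = 1 / (x * of_int k)" using x \<open>y > 0\<close> by (simp add: k[symmetric])
    ultimately show "y \<in> (\<lambda>k. 1 / (x * of_int k)) ` {0..\<lceil>1 / (x * a)\<rceil>}"
      using \<open>0 \<le> k\<close> by auto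
  qed
  then have fin: "finite S" by (rule finite_subset) simp
  have Qc: "continuous_on {a..b} (\<lambda>y. Q (1 / (x * y)))"
    by (rule continuous_on_compose2[OF Q]) (use ab x in \<open>auto intro!: continuous_intros\<close>)
  have "(?D has_integral (?F b - ?F a)) {a..b}"
  proof (rule fundamental_theorem_of_calculus_strong[OF fin ab(2)])
    fix y assume y: "y \<in> {a..b} - S"
    then have y0: "y > 0" and nI: "1 / (x * y) \<notin> \<int>" using ab by (auto simp: S_def)
    have "((\<lambda>y. Q (1 / (x * y))) has_real_derivative R (1 / (x * y)) * (- 1 / (x * y\<^sup>2))) (at y)"
      by (rule DERIV_chain2[where f = Q and g = "\<lambda>y. 1 / (x * y)", OF QR[OF nI]])
         (use y0 x in \<open>auto intro!: derivative_eq_intros simp: field_simps power2_eq_square\<close>)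
    moreover have "((\<lambda>y. - x * y^m) has_real_derivative - x * (real m * y^(m-1))) (at y)"
      by (auto intro!: derivative_eq_intros)
    ultimately have "(?F has_real_derivative
        - x * (real m * y^(m-1)) * Q (1 / (x * y)) + R (1 / (x * y)) * (- 1 / (x * y\<^sup>2)) * (- x * y^m)) (at y)"
      using DERIV_mult by blast
    also have "- x * (real m * y^(m-1)) * Q (1 / (x * y)) + R (1 / (x * y)) * (- 1 / (x * y\<^sup>2)) * (- x * y^m) = ?D y"
      using x by (simp add: field_simps)
    finally show "(?F has_vector_derivative ?D y) (at y)"
      by (simp add: has_real_derivative_iff_has_vector_derivative)
  qed (auto intro!: continuous_intros Qc)
  moreover have "((\<lambda>y. real m * x * (y^(m-1) * Q (1 / (x * y)))) has_integral
      real m * x * integral {a..b} (\<lambda>y. y^(m-1) * Q (1 / (x * y)))) {a..b}"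
    by (intro has_integral_mult_right integrable_integral integrable_continuous_interval
        continuous_intros Qc)
  ultimately have "((\<lambda>y. ?D y + real m * x * (y^(m-1) * Q (1 / (x * y)))) has_integral
      (?F b - ?F a + real m * x * integral {a..b} (\<lambda>y. y^(m-1) * Q (1 / (x * y))))) {a..b}"
    by (rule has_integral_add)
  then show ?thesis by (simp add: algebra_simps)
qed

text \<open>The boundary terms are at most \<open>x * a^m / 2\<close> and
  \<open>x * b^m / 2\<close>. In the remaining integral the factor m cancels against the integral of
  \<open>y^(m-1)\<close>, leaving at most \<open>x * (b^m - a^m) / 2\<close>. The terms in a cancel,
  so the bound is uniform as a tends to 0.\<close>

lemma oscillation_bound:
  fixes Q R :: "real \<Rightarrow> real"
  assumes Q: "continuous_on UNIV Q" and Qb: "\<And>u. \<bar>Q u\<bar> \<le> 1/2"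
    and QR: "\<And>u. u \<notin> \<int> \<Longrightarrow> (Q has_real_derivative R u) (at u)"
    and ab: "0 < a" "a \<le> b" and x: "0 < x" and m: "0 < m"
  shows "\<bar>integral {a..b} (\<lambda>y. y^m / y\<^sup>2 * R (1 / (x * y)))\<bar> \<le> x * b^m"
proof -
  let ?J = "integral {a..b} (\<lambda>y. y^(m-1) * Q (1 / (x * y)))"
  have Qc: "continuous_on {a..b} (\<lambda>y. Q (1 / (x * y)))"
    by (rule continuous_on_compose2[OF Q]) (use ab x in \<open>auto intro!: continuous_intros\<close>)
  have pw: "((\<lambda>y. real m * y^(m-1)) has_integral (b^m - a^m)) {a..b}"
    using ab by (intro fundamental_theorem_of_calculus)
      (auto intro!: derivative_eq_intros simp: has_real_derivative_iff_has_vector_derivative[symmetric])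
  have "norm ?J \<le> integral {a..b} (\<lambda>y. 1 / (2 * real m) * (real m * y^(m-1)))"
  proof (rule integral_norm_bound_integral)
    show "(\<lambda>y. y^(m-1) * Q (1 / (x * y))) integrable_on {a..b}"
      by (intro integrable_continuous_interval continuous_intros Qc)
    fix y assume "y \<in> {a..b}"
    then have "y^(m-1) * \<bar>Q (1 / (x * y))\<bar> \<le> y^(m-1) * (1/2)"
      using ab Qb by (intro mult_left_mono) auto
    then show "norm (y^(m-1) * Q (1 / (x * y))) \<le> 1 / (2 * real m) * (real m * y^(m-1))"
      using ab m \<open>y \<in> {a..b}\<close> by (simp add: abs_mult)
  qed (intro integrable_continuous_interval continuous_intros)
  also have "\<dots> = 1 / (2 * real m) * (b^m - a^m)"
    using integral_unique[OF pw] by (simp only: integral_mult_right)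
  finally have "real m * x * \<bar>?J\<bar> \<le> real m * x * (1 / (2 * real m) * (b^m - a^m))"
    using x by (intro mult_left_mono) auto
  then have J: "\<bar>real m * x * ?J\<bar> \<le> x * (b^m - a^m) / 2"
    using m x by (simp add: abs_mult)
  have "\<bar>x * c^m * Q u\<bar> \<le> x * c^m / 2" if "c > 0" for c u
    using mult_left_mono[OF Qb[of u], of "x * c^m"] x that by (simp add: abs_mult)
  then have "\<bar>x * a^m * Q (1 / (x * a))\<bar> \<le> x * a^m / 2" "\<bar>x * b^m * Q (1 / (x * b))\<bar> \<le> x * b^m / 2"
    using ab by auto
  moreover have "x * (b^m - a^m) / 2 = x * b^m / 2 - x * a^m / 2"
    by (simp add: field_simps)
  ultimately show ?thesis
    using J integral_unique[OF oscillation_has_integral[where R = R, OF Q QR ab x m]] by linarith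
qed

lemma saw1_oscillation_bound:
  assumes "0 < a" "a \<le> b" "0 < x" "0 < m"
  shows "\<bar>integral {a..b} (\<lambda>y. y^m / y\<^sup>2 * saw1 (1 / (x * y)))\<bar> \<le> x * b^m"
  by (rule oscillation_bound[OF continuous_on_saw2 abs_saw2_le saw2_has_real_derivative assms])

lemma saw2_oscillation_bound:
  assumes "0 < a" "a \<le> b" "0 < x" "0 < m"
  shows "\<bar>integral {a..b} (\<lambda>y. y^m / y\<^sup>2 * saw2 (1 / (x * y)))\<bar> \<le> x * b^m"
  by (rule oscillation_bound[OF continuous_on_saw3 abs_saw3_le saw3_has_real_derivative assms])

section \<open>Lebesgue integration on the unit interval\<close>

abbreviation unit_leb :: "real measure" where
  "unit_leb \<equiv> lebesgue_on {0..1}"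

interpretation unit_leb: finite_measure unit_leb
  by (rule finite_measure_lebesgue_on) simp

lemma measure_unit_leb [simp]: "measure unit_leb {0..1} = 1"
  by (simp add: measure_restrict_space)

lemma borel_measurable_unit_leb:
  "g \<in> borel_measurable borel \<Longrightarrow> g \<in> borel_measurable unit_leb"
  by (intro measurable_restrict_space1 measurable_completion) simp

lemma integrable_unit_leb_bounded:
  fixes g :: "real \<Rightarrow> real"
  assumes "g \<in> borel_measurable unit_leb" "\<And>y. y \<in> {0..1} \<Longrightarrow> \<bar>g y\<bar> \<le> c"
  shows "integrable unit_leb g"
  by (rule unit_leb.integrable_const_bound[where B = c]) (use assms in \<open>auto intro!: AE_I2\<close>)

lemma abs_integral_unit_leb_le:
  fixes g h :: "real \<Rightarrow> real"
  assumes "integrable unit_leb h" "\<And>y. y \<in> {0..1} \<Longrightarrow> \<bar>g y\<bar> \<le> h y"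
  shows "\<bar>LINT y|unit_leb. g y\<bar> \<le> (LINT y|unit_leb. h y)"
proof (cases "integrable unit_leb g")
  case True
  have "\<bar>LINT y|unit_leb. g y\<bar> \<le> (LINT y|unit_leb. \<bar>g y\<bar>)"
    by simp
  also have "\<dots> \<le> (LINT y|unit_leb. h y)"
    using True assms by (intro integral_mono) auto
  finally show ?thesis .
next
  case False
  \<comment> \<open>If g is not integrable, its integral is 0 by convention, so it is enough that h
    dominates an absolute value and has nonnegative integral.\<close>
  have "0 \<le> (LINT y|unit_leb. h y)"
    using assms(2) by (intro Bochner_Integration.integral_nonneg) force
  then show ?thesis using False by (simp add: not_integrable_integral_eq)
qed

lemma abs_integral_unit_leb_le_const:
  fixes g :: "real \<Rightarrow> real"
  assumes "\<And>y. y \<in> {0..1} \<Longrightarrow> \<bar>g y\<bar> \<le> c"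
  shows "\<bar>LINT y|unit_leb. g y\<bar> \<le> c"
  using abs_integral_unit_leb_le[of "\<lambda>_. c" g] assms by simp

lemma integrable_unit_leb_indicator:
  fixes g :: "real \<Rightarrow> real"
  assumes "integrable unit_leb g" "A \<in> sets lebesgue"
  shows "integrable unit_leb (\<lambda>y. indicator A y * g y)"
  using integrable_mult_indicator[of "A \<inter> {0..1}" unit_leb g] assms
  by (subst Bochner_Integration.integrable_cong[OF refl, where g = "\<lambda>y. indicator (A \<inter> {0..1}) y *\<^sub>R g y"])
     (auto simp: indicator_def sets_restrict_space)

text \<open>Bridge between the Bochner integrals of the eigenvalue equation and the gauge integrals
  produced by the fundamental theorem of calculus. The half-open version differs only in the null
  set \<open>{a}\<close>.\<close>

lemma
  fixes g :: "real \<Rightarrow> real"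
  assumes g: "integrable unit_leb g" and ab: "0 \<le> a" "b \<le> 1"
  shows integrable_on_unit_leb: "g integrable_on {a..b}"
    and integral_unit_leb_closed: "(LINT y|unit_leb. indicator {a..b} y * g y) = integral {a..b} g"
    and integral_unit_leb_half_open: "(LINT y|unit_leb. indicator {a<..b} y * g y) = integral {a..b} g"
proof -
  have sub: "{a..b} \<subseteq> {0..1}" using ab by auto
  show "g integrable_on {a..b}"
    by (rule integrable_on_subinterval[OF integrable_on_lebesgue_on[OF g] sub]) simp
  have set: "{a..b} \<in> sets lebesgue" "{a<..b} \<in> sets lebesgue" by auto
  have "(LINT y|unit_leb. indicator {a..b} y * g y) = integral {0..1} (\<lambda>y. indicator {a..b} y * g y)"
    by (intro lebesgue_integral_eq_integral integrable_unit_leb_indicator[OF g] set) auto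
  also have eq: "\<dots> = integral {0..1} (\<lambda>y. if y \<in> {a..b} then g y else 0)"
    by (rule arg_cong[where f = "integral {0..1}"]) auto
  also have "\<dots> = integral {a..b} g"
    using sub by (simp only: integral_restrict_Int Int_absorb2)
  finally show "(LINT y|unit_leb. indicator {a..b} y * g y) = integral {a..b} g" .
  have "(LINT y|unit_leb. indicator {a<..b} y * g y) = integral {0..1} (\<lambda>y. indicator {a<..b} y * g y)"
    by (intro lebesgue_integral_eq_integral integrable_unit_leb_indicator[OF g] set) auto
  also have "\<dots> = integral {0..1} (\<lambda>y. if y \<in> {a..b} then g y else 0)"
    by (rule integral_spike[of "{a}"]) (auto simp: indicator_def)
  also have "\<dots> = integral {a..b} g"
    using sub by (simp only: integral_restrict_Int Int_absorb2)
  finally show "(LINT y|unit_leb. indicator {a<..b} y * g y) = integral {a..b} g" .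
qed

lemma
  shows integrable_inverse_sqrt: "integrable unit_leb (\<lambda>z. 1 / sqrt z)"
    and integral_inverse_sqrt: "(LINT z|unit_leb. 1 / sqrt z) = 2"
proof -
  \<comment> \<open>The antiderivative \<open>2 * sqrt z\<close> is continuous on the whole interval
    but differentiable only for z > 0, hence the interior form of the fundamental theorem.
    Nonnegativity then upgrades gauge integrability to Lebesgue integrability.\<close>
  have I: "((\<lambda>z. 1 / sqrt z) has_integral (2 * sqrt 1 - 2 * sqrt 0)) {0..1}"
    by (rule fundamental_theorem_of_calculus_interior)
       (auto intro!: derivative_eq_intros continuous_intros
         simp: has_real_derivative_iff_has_vector_derivative[symmetric] field_simps)
  then have "(\<lambda>z. 1 / sqrt z) absolutely_integrable_on {0..1}"
    by (intro nonnegative_absolutely_integrable_1) auto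
  then show i: "integrable unit_leb (\<lambda>z. 1 / sqrt z)"
    by (simp add: set_integrable_def integrable_restrict_space)
  show "(LINT z|unit_leb. 1 / sqrt z) = 2"
    using lebesgue_integral_eq_integral[OF i] integral_unique[OF I] by simp
qed

text \<open>For z > 0 the integrand is \<open>min 1 (x / z)\<close>; the case distinction gives it
  the value 1 at z = 0, where \<open>x / z\<close> would be 0. The stretch from x to 1 is the source
  of the logarithm in the final bound.\<close>

lemma
  fixes x :: real
  assumes x: "0 < x" "x \<le> 1"
  shows integrable_cut_reciprocal: "integrable unit_leb (\<lambda>z. if z \<le> x then 1 else x / z)"
    and integral_cut_reciprocal: "(LINT z|unit_leb. (if z \<le> x then 1 else x / z)) = x * (1 + ln (1 / x))"
proof -
  let ?h = "\<lambda>z. if z \<le> x then 1 else x / z"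
  show i: "integrable unit_leb ?h"
    using x by (intro integrable_unit_leb_bounded[where c = 1] borel_measurable_unit_leb) auto
  have "((\<lambda>z. 1) has_integral (x - 0)) {0..x}"
    using has_integral_const_real[of "1::real" 0 x] x by simp
  then have 1: "(?h has_integral x) {0..x}"
    using has_integral_cong[of "{0..x}" ?h "\<lambda>z. 1"] by simp
  have "((\<lambda>z. x / z) has_integral (x * ln 1 - x * ln x)) {x..1}"
    using x by (intro fundamental_theorem_of_calculus)
      (auto intro!: derivative_eq_intros simp: has_real_derivative_iff_has_vector_derivative[symmetric])
  then have 2: "(?h has_integral (x * ln 1 - x * ln x)) {x..1}"
    using has_integral_cong[of "{x..1}" ?h "\<lambda>z. x / z"] x by simp
  have "(?h has_integral (x + (x * ln 1 - x * ln x))) {0..1}"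
    by (rule has_integral_combine[OF _ _ 1 2]) (use x in auto)
  then show "(LINT z|unit_leb. ?h z) = x * (1 + ln (1 / x))"
    using lebesgue_integral_eq_integral[OF i] x by (simp add: integral_unique ln_div algebra_simps)
qed

section \<open>The kernel and transforms against it\<close>

lemma K_eq_saw1: "x \<noteq> 0 \<Longrightarrow> y \<noteq> 0 \<Longrightarrow> K x y = saw1 (1 / (x * y))"
  by (simp add: K_def saw1_def)

lemma K_commute: "K x y = K y x"
  by (simp add: K_def mult.commute)

lemma abs_K_le: "\<bar>K x y\<bar> \<le> 1/2"
  using abs_saw1_le[of "1 / (x * y)"] by (auto simp: K_def saw1_def)

lemma K_measurable_pair: "case_prod K \<in> borel_measurable (borel \<Otimes>\<^sub>M borel)"
  unfolding K_def frac_def by measurable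

lemma K_measurable [measurable]: "K x \<in> borel_measurable borel"
  unfolding K_def frac_def by measurable

text \<open>With a = n z one has \<open>min 1 (1 / a) \<le> 2 / (1 + a)\<close>, and
  \<open>4 / (1 + a)\<^sup>2\<close> is dominated by the telescoping difference
  \<open>4 / z * (1 / (1 + (a - z)) - 1 / (1 + a))\<close>. The induction therefore carries the
  remainder \<open>1 / (1 + real N * z)\<close>.\<close>

lemma sum_min_inverse_square_le:
  fixes z :: real
  assumes z: "0 < z"
  shows "(\<Sum>n=1..N. (min 1 (1 / (real n * z)))\<^sup>2) \<le> 4 / z"
proof -
  have "(\<Sum>n=1..N. (min 1 (1 / (real n * z)))\<^sup>2) \<le> 4 / z * (1 - 1 / (1 + real N * z))"
  proof (induction N)
    case (Suc N)
    define a where "a = real (Suc N) * z"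
    have a: "a > 0" "a - z \<ge> 0" using z by (auto simp: a_def mult_le_cancel_right1)
    have "min 1 (1 / a) \<le> 2 / (1 + a)"
      using a by (auto simp: min_def field_simps)
    then have "(min 1 (1 / a))\<^sup>2 \<le> (2 / (1 + a))\<^sup>2"
      using a by (intro power_mono) auto
    also have "\<dots> = 4 / ((1 + a) * (1 + a))"
      by (simp add: power2_eq_square)
    also have "\<dots> \<le> 4 / ((1 + a) * (1 + (a - z)))"
      using a z by (intro divide_left_mono mult_left_mono mult_pos_pos) auto
    also have "\<dots> = 4 / z * (1 / (1 + (a - z)) - 1 / (1 + a))"
    proof -
      have "1 + a \<noteq> 0" "1 + (a - z) \<noteq> 0" "z \<noteq> 0" using a z by auto
      then show ?thesis by (simp add: field_simps)
    qed
    also have "a - z = real N * z" by (simp add: a_def algebra_simps)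
    finally have "(min 1 (1 / a))\<^sup>2 \<le> 4 / z * (1 / (1 + real N * z) - 1 / (1 + a))" .
    moreover have "(1 + real N) * z = a" by (simp add: a_def)
    ultimately show ?case using Suc.IH by (simp add: right_diff_distrib)
  qed simp
  also have "\<dots> \<le> 4 / z * 1"
    using z by (intro mult_left_mono) auto
  finally show ?thesis by simp
qed

text \<open>Allowing any upper bound N of the floor lets one range of summation serve all v at
  once.\<close>

lemma floor_eq_sum_indicator:
  fixes v :: real
  assumes "0 \<le> v" "\<lfloor>v\<rfloor> \<le> int N"
  shows "of_int \<lfloor>v\<rfloor> = (\<Sum>n=1..N. if real n \<le> v then 1 else 0 :: real)"
proof -
  define k where "k = nat \<lfloor>v\<rfloor>"
  have k: "real n \<le> v \<longleftrightarrow> n \<le> k" for n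
    unfolding k_def using assms(1) by (simp add: le_nat_floor le_floor_iff nat_le_iff le_nat_iff)
  have "k \<le> N" using assms(2) by (simp add: k_def)
  then have "{n \<in> {1..N}. n \<le> k} = {1..k}" by auto
  then have "(\<Sum>n=1..N. if real n \<le> v then 1 else 0 :: real) = real k"
    unfolding k by (simp add: sum.If_cases Int_def conj_commute)
  then show ?thesis using assms(1) by (simp add: k_def)
qed

lemma kernel_transform_bound:
  fixes f :: "real \<Rightarrow> real"
  assumes f: "f \<in> borel_measurable unit_leb" and fb: "\<And>y. y \<in> {0..1} \<Longrightarrow> \<bar>f y\<bar> \<le> 1"
    and x: "0 < x" "x \<le> 1" and z: "0 < z" "z \<le> 1"
    and primitive: "\<And>w. w \<in> {0..1} \<Longrightarrow> \<bar>integral {0..w} f\<bar> \<le> x * w\<^sup>2"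
    and log_primitive: "\<bar>integral {x..1} (\<lambda>y. f y / y)\<bar> \<le> x"
  shows "\<bar>LINT y|unit_leb. f y * K y z\<bar> \<le> 8 * x / z"
proof -
  \<comment> \<open>Since \<open>\<lfloor>1 / (y z)\<rfloor>\<close> counts the \<open>n\<close> with \<open>y \<le> 1 / (n z)\<close>, on \<open>{x<..1}\<close> the kernel is \<open>1/2 - 1 / (y z)\<close>
    plus a finite sum of indicators of initial intervals, over which \<open>f\<close> has small integral.\<close>
  define N where "N = nat \<lfloor>1 / (x * z)\<rfloor>"
  define a where "a n = min 1 (1 / (real n * z))" for n
  define F where "F w = integral {0..w} f" for w
  have xz: "x * z > 0" using x z by simp
  have N: "real N \<le> 1 / (x * z)" using xz by (simp add: N_def)
  have a: "x \<le> a n" "a n \<le> 1" if "n \<in> {1..N}" for n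
  proof -
    have "real n \<le> 1 / (x * z)" using that N by simp
    then have "x \<le> 1 / (real n * z)" using that x z by (simp add: field_simps)
    then show "x \<le> a n" "a n \<le> 1" using x by (auto simp: a_def)
  qed
  have id [measurable]: "(\<lambda>y. y) \<in> borel_measurable unit_leb"
    by (rule borel_measurable_unit_leb) simp
  have fi: "integrable unit_leb f" by (rule integrable_unit_leb_bounded[OF f fb])
  \<comment> \<open>Cutting off at x keeps \<open>f y / y\<close> bounded, by
    \<open>1 / x\<close>.\<close>
  define g where "g y = (if y \<le> x then 0 else f y / y)" for y
  have gi: "integrable unit_leb g"
  proof (rule integrable_unit_leb_bounded[where c = "1 / x"])
    show "g \<in> borel_measurable unit_leb"
      unfolding g_def by (intro measurable_If borel_measurable_divide f id) (use id in measurable)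
    fix y :: real assume y: "y \<in> {0..1}"
    have "\<bar>f y\<bar> / y \<le> 1 / x" if "\<not> y \<le> x"
      using that x y fb by (intro frac_le) auto
    then show "\<bar>g y\<bar> \<le> 1 / x" using x y by (auto simp: g_def)
  qed
  define t where "t y = indicator {0..x} y * (f y * K y z)" for y
  have fK: "integrable unit_leb (\<lambda>y. f y * K y z)"
  proof (rule integrable_unit_leb_bounded[where c = 1])
    show "(\<lambda>y. f y * K y z) \<in> borel_measurable unit_leb"
      by (intro borel_measurable_times f borel_measurable_unit_leb)
         (use K_measurable[of z] in \<open>simp add: K_commute[of _ z]\<close>)
    fix y :: real assume "y \<in> {0..1}"
    then show "\<bar>f y * K y z\<bar> \<le> 1"
      using mult_mono[OF fb[of y] abs_K_le[of y z]] by (simp add: abs_mult)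
  qed
  have ti: "integrable unit_leb t"
    unfolding t_def by (rule integrable_unit_leb_indicator[OF fK]) simp
  \<comment> \<open>For y > x the term with g is \<open>f y / (y * z)\<close> and the sum is f y
    times the floor of \<open>1 / (y * z)\<close>, which is at most N. For y \<le> x only t
    survives: the choice of N makes every \<open>a n\<close> at least x, so both indicators in each
    summand equal 1.\<close>
  have decomp: "f y * K y z = t y + 1/2 * (indicator {x<..1} y * f y) - 1 / z * (indicator {x<..1} y * g y)
      + (\<Sum>n=1..N. indicator {0..a n} y * f y - indicator {0..x} y * f y)" if y: "y \<in> {0..1}" for y
  proof (cases "y \<le> x")
    case True
    have "(\<Sum>n=1..N. indicator {0..a n} y * f y - indicator {0..x} y * f y) = 0"
      using True y a by (intro sum.neutral) (force simp: indicator_def)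
    then show ?thesis using True y by (simp add: t_def indicator_def)
  next
    case False
    then have y0: "0 < y" "x < y" using x by auto
    define v where "v = 1 / (y * z)"
    have "v \<le> 1 / (x * z)"
      unfolding v_def using y0 x z by (intro divide_left_mono mult_right_mono mult_pos_pos) auto
    then have "\<lfloor>v\<rfloor> \<le> int N" unfolding N_def using xz floor_mono[of v] by simp
    moreover have v0: "0 \<le> v" using y0 z by (simp add: v_def)
    ultimately have fl: "of_int \<lfloor>v\<rfloor> = (\<Sum>n=1..N. if real n \<le> v then 1 else 0 :: real)"
      by (intro floor_eq_sum_indicator)
    have "(\<Sum>n=1..N. indicator {0..a n} y * f y - indicator {0..x} y * f y)
        = (\<Sum>n=1..N. f y * (if real n \<le> v then 1 else 0))"
    proof (rule sum.cong[OF refl])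
      fix n assume n: "n \<in> {1..N}"
      have "real n \<le> v \<longleftrightarrow> y \<le> 1 / (real n * z)"
        using n y0 z by (simp add: v_def field_simps)
      then show "indicator {0..a n} y * f y - indicator {0..x} y * f y = f y * (if real n \<le> v then 1 else 0)"
        using y y0 by (simp add: a_def indicator_def)
    qed
    also have "\<dots> = f y * of_int \<lfloor>v\<rfloor>" by (simp add: fl sum_distrib_left)
    finally have S: "(\<Sum>n=1..N. indicator {0..a n} y * f y - indicator {0..x} y * f y) = f y * of_int \<lfloor>v\<rfloor>" .
    have kz: "K y z = 1/2 - v + of_int \<lfloor>v\<rfloor>"
      using y0 z by (simp add: K_def v_def frac_def)
    have gz: "1 / z * (1 * g y) = v * f y" using y0 z by (simp add: g_def v_def)
    have "f y * K y z = 0 + 1/2 * (1 * f y) - 1 / z * (1 * g y) + f y * of_int \<lfloor>v\<rfloor>"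
      unfolding kz gz by (simp add: algebra_simps)
    moreover have "t y = 0" "indicator {x<..1} y = (1::real)"
      using y y0 by (auto simp: t_def indicator_def)
    ultimately show ?thesis by (simp only: S)
  qed
  have ind: "integrable unit_leb (\<lambda>y. indicator {c..d} y * f y)"
      "integrable unit_leb (\<lambda>y. indicator {c<..d} y * f y)" for c d
    by (rule integrable_unit_leb_indicator[OF fi]; simp)+
  have indg: "integrable unit_leb (\<lambda>y. indicator {x<..1} y * g y)"
    by (rule integrable_unit_leb_indicator[OF gi]) simp
  have "(LINT y|unit_leb. f y * K y z) = (LINT y|unit_leb. t y + 1/2 * (indicator {x<..1} y * f y)
      - 1 / z * (indicator {x<..1} y * g y)
      + (\<Sum>n=1..N. indicator {0..a n} y * f y - indicator {0..x} y * f y))"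
    by (rule Bochner_Integration.integral_cong[OF refl decomp]) simp
  also have "\<dots> = (LINT y|unit_leb. t y) + 1/2 * (LINT y|unit_leb. indicator {x<..1} y * f y)
      - 1 / z * (LINT y|unit_leb. indicator {x<..1} y * g y)
      + (\<Sum>n=1..N. (LINT y|unit_leb. indicator {0..a n} y * f y) - (LINT y|unit_leb. indicator {0..x} y * f y))"
    by (simp only: Bochner_Integration.integral_add Bochner_Integration.integral_diff
        Bochner_Integration.integral_sum Bochner_Integration.integrable_add
        Bochner_Integration.integrable_diff Bochner_Integration.integrable_sum
        integrable_mult_right integral_mult_right_zero ti ind indg)
  also have "(LINT y|unit_leb. indicator {x<..1} y * f y) = F 1 - F x"
  proof -
    have "integral {0..x} f + integral {x..1} f = integral {0..1} f"
      using x by (intro Henstock_Kurzweil_Integration.integral_combine integrable_on_unit_leb[OF fi]) auto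
    then show ?thesis using integral_unit_leb_half_open[OF fi, of x 1] x by (simp add: F_def)
  qed
  also have "(LINT y|unit_leb. indicator {x<..1} y * g y) = integral {x..1} (\<lambda>y. f y / y)"
  proof -
    have "integral {x..1} g = integral {x..1} (\<lambda>y. f y / y)"
      by (rule integral_spike[of "{x}"]) (auto simp: g_def)
    then show ?thesis using integral_unit_leb_half_open[OF gi, of x 1] x by simp
  qed
  also have "(\<Sum>n=1..N. (LINT y|unit_leb. indicator {0..a n} y * f y) - (LINT y|unit_leb. indicator {0..x} y * f y))
      = (\<Sum>n=1..N. F (a n) - F x)"
    by (rule sum.cong) (use a x in \<open>auto simp: F_def integral_unit_leb_closed[OF fi]\<close>)
  finally have L: "(LINT y|unit_leb. f y * K y z) = (LINT y|unit_leb. t y) + 1/2 * (F 1 - F x)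
      - 1 / z * integral {x..1} (\<lambda>y. f y / y) + (\<Sum>n=1..N. F (a n) - F x)" .
  have xz1: "x \<le> x / z" using x z by (simp add: field_simps)
  have Fb: "\<bar>F w\<bar> \<le> x * w\<^sup>2" if "w \<in> {0..1}" for w
    unfolding F_def using primitive[OF that] .
  have "\<bar>LINT y|unit_leb. t y\<bar> \<le> (LINT y|unit_leb. indicator {0..x} y * 1)"
  proof (rule abs_integral_unit_leb_le)
    show "integrable unit_leb (\<lambda>y. indicator {0..x} y * 1 :: real)"
      by (intro integrable_unit_leb_indicator) auto
    fix y :: real assume "y \<in> {0..1}"
    then show "\<bar>t y\<bar> \<le> indicator {0..x} y * 1"
      using mult_mono[OF fb[of y] abs_K_le[of y z]] by (simp add: abs_mult t_def indicator_def)
  qed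
  also have "\<dots> = x"
    using integral_unit_leb_closed[of "\<lambda>_. 1" 0 x] x by simp
  finally have 1: "\<bar>LINT y|unit_leb. t y\<bar> \<le> x / z" using xz1 by simp
  have x2: "x * x\<^sup>2 \<le> x" using x by (simp add: power_le_one mult_left_le)
  have "\<bar>F 1\<bar> \<le> x" "\<bar>F x\<bar> \<le> x" using Fb[of 1] order.trans[OF Fb[of x] x2] x by auto
  then have "\<bar>F 1 - F x\<bar> \<le> 2 * (x / z)" using xz1 by linarith
  then have 2: "\<bar>1/2 * (F 1 - F x)\<bar> \<le> x / z" by (simp add: abs_mult field_simps)
  have 3: "\<bar>1 / z * integral {x..1} (\<lambda>y. f y / y)\<bar> \<le> x / z"
    using log_primitive z by (simp add: abs_mult field_simps)
  \<comment> \<open>The squares of the \<open>a n\<close> sum to at most \<open>4 / z\<close>. The N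
    copies of \<open>x * x\<^sup>2\<close> cost at most \<open>x * (x / z)\<close>, since N is at
    most \<open>1 / (x * z)\<close>.\<close>
  have "\<bar>\<Sum>n=1..N. F (a n) - F x\<bar> \<le> (\<Sum>n=1..N. x * (a n)\<^sup>2 + x * x\<^sup>2)"
  proof (rule order.trans[OF sum_abs sum_mono])
    fix n assume "n \<in> {1..N}"
    then show "\<bar>F (a n) - F x\<bar> \<le> x * (a n)\<^sup>2 + x * x\<^sup>2"
      using Fb[of "a n"] Fb[of x] a[of n] x by (intro order.trans[OF abs_triangle_ineq4] add_mono) auto
  qed
  also have "\<dots> = x * (\<Sum>n=1..N. (a n)\<^sup>2) + real N * (x * x\<^sup>2)"
    by (simp add: sum.distrib sum_distrib_left)
  also have "\<dots> \<le> x * (4 / z) + 1 / (x * z) * (x * x\<^sup>2)"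
    using sum_min_inverse_square_le[OF z(1), of N] N x
    unfolding a_def by (intro add_mono mult_left_mono mult_right_mono) auto
  also have "\<dots> = 4 * (x / z) + x * (x / z)"
    using x by (simp add: power2_eq_square)
  also have "x * (x / z) \<le> 1 * (x / z)"
    using x z by (intro mult_right_mono) auto
  finally have 4: "\<bar>\<Sum>n=1..N. F (a n) - F x\<bar> \<le> 5 * (x / z)" by simp
  \<comment> \<open>In units of \<open>x / z\<close> the four contributions are 1, 1, 1 and
    5.\<close>
  have "\<bar>LINT y|unit_leb. f y * K y z\<bar> \<le> 8 * (x / z)"
    unfolding L using 1 2 3 4 by linarith
  then show ?thesis by simp
qed

section \<open>Iterated, weighted and integrated kernels\<close>

lemma integral_from_zero_bound:
  fixes f :: "real \<Rightarrow> real"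
  assumes f: "f integrable_on {0..w}" and fb: "\<And>y. y \<in> {0..w} \<Longrightarrow> \<bar>f y\<bar> \<le> 1" and w: "0 < w"
    and B: "\<And>a. 0 < a \<Longrightarrow> a \<le> w \<Longrightarrow> \<bar>integral {a..w} f + c\<bar> \<le> B + a"
  shows "\<bar>integral {0..w} f + c\<bar> \<le> B"
proof (rule field_le_epsilon)
  fix e :: real assume e: "0 < e"
  \<comment> \<open>The oscillation formulas require a positive left end a. The interval
    \<open>{0..a}\<close> contributes at most a, because f is bounded by 1, and assumption
    \<open>B\<close> allows another a, so a \<le> e/2 is small enough.\<close>
  define a where "a = min w (e / 2)"
  have a: "0 < a" "a \<le> w" "a \<le> e / 2" using w e by (auto simp: a_def)
  have "f integrable_on {0..a}"
    using a by (intro integrable_on_subinterval[OF f]) auto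
  then have "norm (integral {0..a} f) \<le> integral {0..a} (\<lambda>_. 1)"
    using a fb by (intro integral_norm_bound_integral) auto
  then have "\<bar>integral {0..a} f\<bar> \<le> a" using a by simp
  moreover have "integral {0..a} f + integral {a..w} f = integral {0..w} f"
    using a f by (intro Henstock_Kurzweil_Integration.integral_combine) auto
  ultimately show "\<bar>integral {0..w} f + c\<bar> \<le> B + e"
    using B[OF a(1,2)] a(3) by linarith
qed

lemma K_integrable: "integrable unit_leb (K x)"
  by (rule integrable_unit_leb_bounded[OF borel_measurable_unit_leb[OF K_measurable] abs_K_le])

lemma K_zero_right [simp]: "K y 0 = 0"
  by (simp add: K_def)

text \<open>This is \<open>kernel_transform_bound\<close> for f = \<open>K x\<close>: the weights 1
  and 1/y in its two hypotheses are the cases m = 2 and m = 1 of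
  \<open>saw1_oscillation_bound\<close>. At z = 0 both sides are 0, the right one by the convention
  for division.\<close>

lemma iterated_kernel_bound:
  assumes x: "0 < x" "x \<le> 1" and z: "0 \<le> z" "z \<le> 1"
  shows "\<bar>LINT y|unit_leb. K x y * K y z\<bar> \<le> 8 * x / z"
proof (cases "z = 0")
  case False
  show ?thesis
  proof (rule kernel_transform_bound)
    fix w :: real assume w: "w \<in> {0..1}"
    show "\<bar>integral {0..w} (K x)\<bar> \<le> x * w\<^sup>2"
    proof (cases "w = 0")
      case False
      have "\<bar>integral {0..w} (K x) + 0\<bar> \<le> x * w\<^sup>2"
      proof (rule integral_from_zero_bound)
        fix a assume a: "0 < a" "a \<le> w"
        have "integral {a..w} (K x) = integral {a..w} (\<lambda>y. y^2 / y\<^sup>2 * saw1 (1 / (x * y)))"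
          using a x by (intro Henstock_Kurzweil_Integration.integral_cong) (auto simp: K_eq_saw1)
        then show "\<bar>integral {a..w} (K x) + 0\<bar> \<le> x * w\<^sup>2 + a"
          using saw1_oscillation_bound[OF a x(1), of 2] a by simp
      next
        show "\<bar>K x y\<bar> \<le> 1" for y using abs_K_le[of x y] by simp
      qed (use w False integrable_on_unit_leb[OF K_integrable] in auto)
      then show ?thesis by simp
    qed simp
  next
    have "integral {x..1} (\<lambda>y. K x y / y) = integral {x..1} (\<lambda>y. y^1 / y\<^sup>2 * saw1 (1 / (x * y)))"
      using x by (intro Henstock_Kurzweil_Integration.integral_cong) (auto simp: K_eq_saw1 power2_eq_square)
    then show "\<bar>integral {x..1} (\<lambda>y. K x y / y)\<bar> \<le> x"
      using saw1_oscillation_bound[OF x x(1), of 1] by simp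
  next
    show "\<bar>K x y\<bar> \<le> 1" for y using abs_K_le[of x y] by simp
  qed (use x z False in \<open>auto intro: borel_measurable_unit_leb\<close>)
qed simp

lemma saw2_weight_measurable: "(\<lambda>y. y * saw2 (1 / (x * y))) \<in> borel_measurable unit_leb"
  by (rule borel_measurable_unit_leb) measurable

lemma saw2_weight_bound: "y \<in> {0..1} \<Longrightarrow> \<bar>y * saw2 (1 / (x * y))\<bar> \<le> 1"
  using mult_mono[OF _ abs_saw2_le[of "1 / (x * y)"], of y 1] by (simp add: abs_mult)

text \<open>The same scheme one primitive further: the weights y and 1 are the cases m = 3 and m = 2
  of \<open>saw2_oscillation_bound\<close>. The resulting \<open>w^3\<close> is weakened to
  \<open>w\<^sup>2\<close> on the unit interval.\<close>

lemma saw2_kernel_transform_bound: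
  assumes x: "0 < x" "x \<le> 1" and z: "0 \<le> z" "z \<le> 1"
  shows "\<bar>LINT y|unit_leb. y * saw2 (1 / (x * y)) * K y z\<bar> \<le> 8 * x / z"
proof (cases "z = 0")
  case False
  let ?f = "\<lambda>y. y * saw2 (1 / (x * y))"
  have fi: "integrable unit_leb ?f"
    by (rule integrable_unit_leb_bounded[OF saw2_weight_measurable saw2_weight_bound])
  show ?thesis
  proof (rule kernel_transform_bound)
    fix w :: real assume w: "w \<in> {0..1}"
    show "\<bar>integral {0..w} ?f\<bar> \<le> x * w\<^sup>2"
    proof (cases "w = 0")
      case False
      have "\<bar>integral {0..w} ?f + 0\<bar> \<le> x * w^3"
      proof (rule integral_from_zero_bound)
        fix a assume a: "0 < a" "a \<le> w"
        have "integral {a..w} ?f = integral {a..w} (\<lambda>y. y^3 / y\<^sup>2 * saw2 (1 / (x * y)))"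
          using a x by (intro Henstock_Kurzweil_Integration.integral_cong)
            (auto simp: power2_eq_square power3_eq_cube)
        then show "\<bar>integral {a..w} ?f + 0\<bar> \<le> x * w^3 + a"
          using saw2_oscillation_bound[OF a x(1), of 3] a by simp
      qed (use w False saw2_weight_bound[of _ x] integrable_on_unit_leb[OF fi] in auto)
      also have "w^3 \<le> w\<^sup>2" using w by (intro power_decreasing) auto
      finally show ?thesis using x by simp
    qed simp
  next
    have "integral {x..1} (\<lambda>y. ?f y / y) = integral {x..1} (\<lambda>y. y^2 / y\<^sup>2 * saw2 (1 / (x * y)))"
      using x by (intro Henstock_Kurzweil_Integration.integral_cong) auto
    then show "\<bar>integral {x..1} (\<lambda>y. ?f y / y)\<bar> \<le> x"
      using saw2_oscillation_bound[OF x x(1), of 2] by simp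
  qed (use x z False saw2_weight_measurable saw2_weight_bound in auto)
qed simp

text \<open>Here t oscillates with parameter y. The first integration by parts (m = 2) leaves the
  main term as boundary term at x, plus 2 y times the integral of
  \<open>t * saw2 (1 / (y * t))\<close>; a second one (m = 3) bounds that integral by
  \<open>x^3\<close>. The boundary term at a is at most a, which
  \<open>integral_from_zero_bound\<close> tolerates.\<close>

lemma integrated_kernel_expansion:
  assumes x: "0 < x" "x \<le> 1" and y: "0 \<le> y" "y \<le> 1"
  shows "\<bar>integral {0..x} (\<lambda>t. K t y) + x\<^sup>2 * (y * saw2 (1 / (x * y)))\<bar> \<le> 2 * x^3"
proof (cases "y = 0")
  case True
  then show ?thesis using x by simp
next
  case False
  then have y0: "0 < y" using y by simp
  show ?thesis
  proof (rule integral_from_zero_bound)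
    show "(\<lambda>t. K t y) integrable_on {0..x}"
      using integrable_on_unit_leb[OF K_integrable[of y], of 0 x] x by (simp add: K_commute[of _ y])
    show "\<bar>K t y\<bar> \<le> 1" for t using abs_K_le[of t y] by simp
    fix a assume a: "0 < a" "a \<le> x"
    let ?J = "integral {a..x} (\<lambda>t. t * saw2 (1 / (y * t)))"
    have "integral {a..x} (\<lambda>t. K t y) = integral {a..x} (\<lambda>t. t^2 / t\<^sup>2 * saw1 (1 / (y * t)))"
      using a y0 by (intro Henstock_Kurzweil_Integration.integral_cong) (auto simp: K_eq_saw1 mult.commute)
    also have "\<dots> = y * a^2 * saw2 (1 / (y * a)) - y * x^2 * saw2 (1 / (y * x)) + real 2 * y * ?J"
      using integral_unique[OF oscillation_has_integral[where R = saw1,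
          OF continuous_on_saw2 saw2_has_real_derivative a y0, of 2]] by simp
    finally have eq: "integral {a..x} (\<lambda>t. K t y) + x\<^sup>2 * (y * saw2 (1 / (x * y)))
        = y * a^2 * saw2 (1 / (y * a)) + 2 * y * ?J"
      by (simp add: algebra_simps)
    have "?J = integral {a..x} (\<lambda>t. t^3 / t\<^sup>2 * saw2 (1 / (y * t)))"
      using a by (intro Henstock_Kurzweil_Integration.integral_cong)
        (auto simp: power2_eq_square power3_eq_cube)
    then have "\<bar>?J\<bar> \<le> y * x^3"
      using saw2_oscillation_bound[OF a y0, of 3] by simp
    also have "\<dots> \<le> x^3" using x y by (simp add: mult_left_le_one_le)
    finally have "y * \<bar>?J\<bar> \<le> 1 * x^3" using y by (intro mult_mono) auto
    moreover have "\<bar>y * a^2 * saw2 (1 / (y * a))\<bar> \<le> a"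
    proof -
      have "\<bar>y * a^2 * saw2 (1 / (y * a))\<bar> = y * a * (a * \<bar>saw2 (1 / (y * a))\<bar>)"
        using a y by (simp add: abs_mult power2_eq_square)
      also have "\<dots> \<le> 1 * a * (1 * 1)"
        using a x y abs_saw2_le[of "1 / (y * a)"] by (intro mult_mono) auto
      finally show ?thesis by simp
    qed
    moreover have "\<bar>2 * y * ?J\<bar> = 2 * (y * \<bar>?J\<bar>)" using y by (simp add: abs_mult)
    ultimately show "\<bar>integral {a..x} (\<lambda>t. K t y) + x\<^sup>2 * (y * saw2 (1 / (x * y)))\<bar> \<le> 2 * x^3 + a"
      unfolding eq by linarith
  qed (use x in auto)
qed

section \<open>Bounds for eigenfunctions, their moments and their primitives\<close>

lemma eigenfunction_bounds:
  assumes eig: "is_eigenfunction \<phi> \<mu>" and norm: "ip \<phi> \<phi> = 1"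
  shows eigenfunction_measurable: "\<phi> \<in> borel_measurable unit_leb"
    and eigenfunction_integral_abs_le: "(LINT y|unit_leb. \<bar>\<phi> y\<bar>) \<le> 1"
    and eigenfunction_abs_le: "\<And>x. x \<in> {0..1} \<Longrightarrow> \<bar>\<phi> x\<bar> \<le> \<bar>\<mu>\<bar>"
    and eigenvalue_abs_ge: "1 \<le> \<bar>\<mu>\<bar>"
proof -
  show m: "\<phi> \<in> borel_measurable unit_leb"
    using eig by (simp add: is_eigenfunction_def L2_def)
  have i2: "integrable unit_leb (\<lambda>x. (\<phi> x)\<^sup>2)"
    using eig by (simp add: is_eigenfunction_def L2_def)
  have n: "(LINT x|unit_leb. (\<phi> x)\<^sup>2) = 1"
    using norm by (simp add: ip_def power2_eq_square)
  \<comment> \<open>Stands in for Cauchy-Schwarz: on a space of measure 1 and for unit norm, the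
    right side integrates to 1.\<close>
  have pw: "\<bar>t\<bar> \<le> (1 + t\<^sup>2) / 2" for t :: real
    using zero_le_power2[of "1 - \<bar>t\<bar>"] by (simp add: power2_diff)
  have ib: "integrable unit_leb (\<lambda>x. (1 + (\<phi> x)\<^sup>2) / 2)"
    using i2 by simp
  have i: "integrable unit_leb \<phi>"
    by (rule Bochner_Integration.integrable_bound[OF ib m]) (use pw in \<open>auto intro!: AE_I2 order.trans[OF _ abs_ge_self]\<close>)
  have "(LINT y|unit_leb. \<bar>\<phi> y\<bar>) \<le> (LINT y|unit_leb. (1 + (\<phi> y)\<^sup>2) / 2)"
    using i ib pw by (intro integral_mono) auto
  also have "\<dots> = 1"
    using i2 n by simp
  finally show abs: "(LINT y|unit_leb. \<bar>\<phi> y\<bar>) \<le> 1" .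
  show b: "\<bar>\<phi> x\<bar> \<le> \<bar>\<mu>\<bar>" if "x \<in> {0..1}" for x
  proof -
    have "\<bar>LINT y|unit_leb. K x y * \<phi> y\<bar> \<le> (LINT y|unit_leb. \<bar>\<phi> y\<bar>)"
    proof (rule abs_integral_unit_leb_le)
      show "integrable unit_leb (\<lambda>y. \<bar>\<phi> y\<bar>)" using i by simp
      show "\<bar>K x y * \<phi> y\<bar> \<le> \<bar>\<phi> y\<bar>" for y
        using abs_K_le[of x y] by (auto simp: abs_mult intro!: mult_left_le_one_le)
    qed
    then have "\<bar>\<mu>\<bar> * \<bar>LINT y|unit_leb. K x y * \<phi> y\<bar> \<le> \<bar>\<mu>\<bar> * 1"
      using abs by (intro mult_left_mono) auto
    moreover have "\<phi> x = \<mu> * (LINT y|unit_leb. K x y * \<phi> y)"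
      using eig that by (simp add: is_eigenfunction_def)
    ultimately show ?thesis by (simp add: abs_mult)
  qed
  \<comment> \<open>Unit norm and the pointwise bound force \<open>1 \<le> \<mu>\<^sup>2\<close>;
    this later absorbs lower-order terms into powers of the eigenvalue.\<close>
  have "\<bar>LINT x|unit_leb. (\<phi> x)\<^sup>2\<bar> \<le> \<mu>\<^sup>2"
    by (rule abs_integral_unit_leb_le_const) (use b in \<open>auto simp: abs_le_square_iff\<close>)
  then have "1\<^sup>2 \<le> \<bar>\<mu>\<bar>\<^sup>2" using n by simp
  then show "1 \<le> \<bar>\<mu>\<bar>" by (rule power2_le_imp_le) simp
qed

text \<open>Inserting the eigenvalue equation for \<open>\<phi> y\<close> and exchanging the
  integrals moves the kernel from the eigenfunction onto f. Fubini applies because f, K and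
  \<open>\<phi>\<close> are bounded on the unit square.\<close>

lemma
  assumes eig: "is_eigenfunction \<phi> \<mu>" and norm: "ip \<phi> \<phi> = 1"
    and f: "f \<in> borel_measurable unit_leb" and fb: "\<And>y. y \<in> {0..1} \<Longrightarrow> \<bar>f y\<bar> \<le> 1"
  shows integrable_eigenfunction_transform:
      "integrable unit_leb (\<lambda>z. \<phi> z * (LINT y|unit_leb. f y * K y z))"
    and eigenfunction_pairing:
      "(LINT y|unit_leb. f y * \<phi> y) = \<mu> * (LINT z|unit_leb. \<phi> z * (LINT y|unit_leb. f y * K y z))"
proof -
  interpret P: pair_sigma_finite unit_leb unit_leb ..
  interpret PF: finite_measure "unit_leb \<Otimes>\<^sub>M unit_leb"
    by (rule finite_measure_pair_measure) unfold_locales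
  note \<phi> = eigenfunction_measurable[OF eig norm] and \<phi>b = eigenfunction_abs_le[OF eig norm]
  have id: "(\<lambda>y. y) \<in> borel_measurable unit_leb"
    by (rule borel_measurable_unit_leb) simp
  \<comment> \<open>Borel measurability of K is pulled back along the identity in each coordinate,
    from Borel sets to the Lebesgue sets of \<open>unit_leb\<close>.\<close>
  have Km: "(\<lambda>p. K (fst p) (snd p)) \<in> borel_measurable (unit_leb \<Otimes>\<^sub>M unit_leb)"
    using measurable_compose[OF measurable_Pair[OF measurable_compose[OF measurable_fst id]
          measurable_compose[OF measurable_snd id]] K_measurable_pair] by simp
  have int: "integrable (unit_leb \<Otimes>\<^sub>M unit_leb) (\<lambda>(y, z). f y * (K y z * \<phi> z))"
  proof (rule PF.integrable_const_bound[where B = "1 * (1/2 * \<bar>\<mu>\<bar>)"])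
    show "(\<lambda>(y, z). f y * (K y z * \<phi> z)) \<in> borel_measurable (unit_leb \<Otimes>\<^sub>M unit_leb)"
      unfolding case_prod_beta
      by (intro borel_measurable_times Km measurable_compose[OF measurable_fst f]
          measurable_compose[OF measurable_snd \<phi>])
    show "AE p in unit_leb \<Otimes>\<^sub>M unit_leb. norm (case p of (y, z) \<Rightarrow> f y * (K y z * \<phi> z)) \<le> 1 * (1/2 * \<bar>\<mu>\<bar>)"
    proof (rule AE_I2)
      fix p assume "p \<in> space (unit_leb \<Otimes>\<^sub>M unit_leb)"
      then have "fst p \<in> {0..1}" "snd p \<in> {0..1}" by (auto simp: space_pair_measure)
      then have "\<bar>f (fst p)\<bar> * (\<bar>K (fst p) (snd p)\<bar> * \<bar>\<phi> (snd p)\<bar>) \<le> 1 * (1/2 * \<bar>\<mu>\<bar>)"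
        using fb \<phi>b abs_K_le by (intro mult_mono) auto
      then show "norm (case p of (y, z) \<Rightarrow> f y * (K y z * \<phi> z)) \<le> 1 * (1/2 * \<bar>\<mu>\<bar>)"
        by (simp add: case_prod_beta abs_mult)
    qed
  qed
  have inner: "(LINT y|unit_leb. f y * (K y z * \<phi> z)) = \<phi> z * (LINT y|unit_leb. f y * K y z)" for z
  proof -
    have "(\<lambda>y. f y * (K y z * \<phi> z)) = (\<lambda>y. \<phi> z * (f y * K y z))"
      by (simp add: ac_simps)
    then show ?thesis by (simp only: integral_mult_right_zero)
  qed
  show "integrable unit_leb (\<lambda>z. \<phi> z * (LINT y|unit_leb. f y * K y z))"
    using P.integrable_snd[OF int] by (simp only: inner)
  have "(LINT y|unit_leb. f y * \<phi> y) = (LINT y|unit_leb. \<mu> * (LINT z|unit_leb. f y * (K y z * \<phi> z)))"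
    using eig by (intro Bochner_Integration.integral_cong) (auto simp: is_eigenfunction_def)
  also have "\<dots> = \<mu> * (LINT y|unit_leb. LINT z|unit_leb. f y * (K y z * \<phi> z))"
    by simp
  also have "\<dots> = \<mu> * (LINT z|unit_leb. \<phi> z * (LINT y|unit_leb. f y * K y z))"
    using P.Fubini_integral[OF int] by (simp only: inner)
  finally show "(LINT y|unit_leb. f y * \<phi> y) = \<mu> * (LINT z|unit_leb. \<phi> z * (LINT y|unit_leb. f y * K y z))" .
qed

lemma kernel_transform_abs_le_1:
  assumes "\<And>y. y \<in> {0..1} \<Longrightarrow> \<bar>f y\<bar> \<le> 1"
  shows "\<bar>LINT y|unit_leb. f y * K y z\<bar> \<le> 1"
proof (rule abs_integral_unit_leb_le_const)
  fix y :: real assume "y \<in> {0..1}"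
  then show "\<bar>f y * K y z\<bar> \<le> 1"
    using mult_mono[OF assms[of y] abs_K_le[of y z]] by (simp add: abs_mult)
qed

text \<open>The eigenvalue equation is used twice, via pairing with f = \<open>K x\<close>. The
  iterated kernel is bounded by 1 and by \<open>8 * x / z\<close>, hence by
  \<open>8 * sqrt (x / z)\<close> in either range of z. Integrating against
  \<open>\<bar>\<phi>\<bar> \<le> \<bar>\<mu>\<bar>\<close> gives the third factor
  \<open>\<bar>\<mu>\<bar>\<close> and the constant 8 * 2 = 16.\<close>

lemma eigenfunction_sqrt_bound:
  assumes eig: "is_eigenfunction \<phi> \<mu>" and norm: "ip \<phi> \<phi> = 1" and x: "0 \<le> x" "x \<le> 1"
  shows "\<bar>\<phi> x\<bar> \<le> 16 * \<bar>\<mu>\<bar>^3 * sqrt x"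
proof (cases "x = 0")
  case True
  have "\<phi> 0 = \<mu> * (LINT y|unit_leb. K 0 y * \<phi> y)"
    using eig by (simp add: is_eigenfunction_def)
  also have "\<dots> = 0" by (simp add: K_def)
  finally show ?thesis using True by simp
next
  case False
  then have x0: "0 < x" using x by simp
  have Kb: "\<bar>K x y\<bar> \<le> 1" for y using abs_K_le[of x y] by simp
  define T where "T z = (LINT y|unit_leb. K x y * K y z)" for z
  have Tb: "\<bar>T z\<bar> \<le> 8 * sqrt x * (1 / sqrt z)" if z: "z \<in> {0..1}" for z
  proof (cases "z = 0")
    case True
    then show ?thesis by (simp add: T_def)
  next
    case False
    then have z0: "0 < z" using z by simp
    have T8: "\<bar>T z\<bar> \<le> 8 * (x / z)"
      using iterated_kernel_bound[OF x0 x(2), of z] z by (simp add: T_def)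
    have T1: "\<bar>T z\<bar> \<le> 1"
      unfolding T_def by (rule kernel_transform_abs_le_1) (rule Kb)
    have "\<bar>T z\<bar> \<le> 8 * sqrt (x / z)"
    proof (cases "x \<le> z")
      case True
      then have "(x / z)\<^sup>2 \<le> x / z"
        using x0 z0 power_decreasing[of 1 2 "x / z"] by simp
      then have "x / z \<le> sqrt (x / z)" by (rule real_le_rsqrt)
      then show ?thesis using T8 by simp
    next
      case False
      then have "1 \<le> sqrt (x / z)" using z0 by simp
      then show ?thesis using T1 by linarith
    qed
    then show ?thesis by (simp add: real_sqrt_divide)
  qed
  have "\<bar>LINT z|unit_leb. \<phi> z * T z\<bar> \<le> (LINT z|unit_leb. 8 * \<bar>\<mu>\<bar> * sqrt x * (1 / sqrt z))"
  proof (rule abs_integral_unit_leb_le)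
    show "integrable unit_leb (\<lambda>z. 8 * \<bar>\<mu>\<bar> * sqrt x * (1 / sqrt z))"
      by (intro integrable_mult_right integrable_inverse_sqrt)
    fix z :: real assume z: "z \<in> {0..1}"
    have "\<bar>\<phi> z\<bar> * \<bar>T z\<bar> \<le> \<bar>\<mu>\<bar> * (8 * sqrt x * (1 / sqrt z))"
      using Tb[OF z] eigenfunction_abs_le[OF eig norm z] by (intro mult_mono) auto
    then show "\<bar>\<phi> z * T z\<bar> \<le> 8 * \<bar>\<mu>\<bar> * sqrt x * (1 / sqrt z)"
      by (simp add: abs_mult ac_simps)
  qed
  also have "\<dots> = 16 * \<bar>\<mu>\<bar> * sqrt x"
    by (simp only: integral_mult_right_zero integral_inverse_sqrt)
  finally have I: "\<bar>LINT z|unit_leb. \<phi> z * T z\<bar> \<le> 16 * \<bar>\<mu>\<bar> * sqrt x" .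
  have "\<phi> x = \<mu> * (LINT y|unit_leb. K x y * \<phi> y)"
    using eig x by (simp add: is_eigenfunction_def)
  also have "(LINT y|unit_leb. K x y * \<phi> y) = \<mu> * (LINT z|unit_leb. \<phi> z * T z)"
    unfolding T_def
    by (rule eigenfunction_pairing[OF eig norm borel_measurable_unit_leb[OF K_measurable] Kb])
  finally have "\<bar>\<phi> x\<bar> = \<bar>\<mu>\<bar>\<^sup>2 * \<bar>LINT z|unit_leb. \<phi> z * T z\<bar>"
    by (simp add: abs_mult power2_eq_square)
  also have "\<dots> \<le> \<bar>\<mu>\<bar>\<^sup>2 * (16 * \<bar>\<mu>\<bar> * sqrt x)"
    by (intro mult_left_mono I) simp
  finally show ?thesis by (simp add: power2_eq_square power3_eq_cube ac_simps)
qed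

text \<open>Both bounds start from the same pairing and differ in the estimate of the eigenfunction.
  The square-root bound against \<open>8 * x / z\<close> gives 16 * 8 * 2 = 256 with
  \<open>\<mu>^4\<close>; the bound \<open>\<bar>\<mu>\<bar>\<close> against
  \<open>8 * min 1 (x / z)\<close> gives the logarithm with only
  \<open>\<mu>\<^sup>2\<close>.\<close>

lemma saw2_moment_bounds:
  assumes eig: "is_eigenfunction \<phi> \<mu>" and norm: "ip \<phi> \<phi> = 1" and x: "0 < x" "x \<le> 1"
  shows "\<bar>LINT y|unit_leb. y * saw2 (1 / (x * y)) * \<phi> y\<bar> \<le> 256 * \<mu>^4 * x"
    and "\<bar>LINT y|unit_leb. y * saw2 (1 / (x * y)) * \<phi> y\<bar> \<le> 8 * \<mu>\<^sup>2 * x * (1 + ln (1 / x))"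
proof -
  define T where "T z = (LINT y|unit_leb. y * saw2 (1 / (x * y)) * K y z)" for z
  have T8: "\<bar>T z\<bar> \<le> 8 * x / z" if "z \<in> {0..1}" for z
    unfolding T_def using saw2_kernel_transform_bound[OF x] that by simp
  have T1: "\<bar>T z\<bar> \<le> 1" for z
    unfolding T_def by (rule kernel_transform_abs_le_1[OF saw2_weight_bound])
  have J: "(LINT y|unit_leb. y * saw2 (1 / (x * y)) * \<phi> y) = \<mu> * (LINT z|unit_leb. \<phi> z * T z)"
    unfolding T_def
    by (rule eigenfunction_pairing[OF eig norm saw2_weight_measurable saw2_weight_bound])
  have "\<bar>LINT z|unit_leb. \<phi> z * T z\<bar> \<le> (LINT z|unit_leb. 128 * \<bar>\<mu>\<bar>^3 * x * (1 / sqrt z))"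
  proof (rule abs_integral_unit_leb_le)
    show "integrable unit_leb (\<lambda>z. 128 * \<bar>\<mu>\<bar>^3 * x * (1 / sqrt z))"
      by (intro integrable_mult_right integrable_inverse_sqrt)
    fix z :: real assume z: "z \<in> {0..1}"
    have "\<bar>\<phi> z\<bar> * \<bar>T z\<bar> \<le> 16 * \<bar>\<mu>\<bar>^3 * sqrt z * (8 * x / z)"
      using T8[OF z] eigenfunction_sqrt_bound[OF eig norm, of z] z by (intro mult_mono) auto
    also have "\<dots> = 128 * \<bar>\<mu>\<bar>^3 * x * (sqrt z / z)" by simp
    \<comment> \<open>Holds at z = 0 as well, where both sides are 0.\<close>
    also have "sqrt z / z = 1 / sqrt z"
      using z by (simp add: sqrt_divide_self_eq inverse_eq_divide)
    finally show "\<bar>\<phi> z * T z\<bar> \<le> 128 * \<bar>\<mu>\<bar>^3 * x * (1 / sqrt z)"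
      by (simp add: abs_mult)
  qed
  also have "\<dots> = 256 * \<bar>\<mu>\<bar>^3 * x"
    by (simp only: integral_mult_right_zero integral_inverse_sqrt)
  finally have "\<bar>\<mu>\<bar> * \<bar>LINT z|unit_leb. \<phi> z * T z\<bar> \<le> \<bar>\<mu>\<bar> * (256 * \<bar>\<mu>\<bar>^3 * x)"
    by (intro mult_left_mono) auto
  also have "\<dots> = 256 * \<bar>\<mu>\<bar>^4 * x" by (simp add: power_numeral_reduce)
  also have "\<bar>\<mu>\<bar>^4 = \<mu>^4" by simp
  finally show "\<bar>LINT y|unit_leb. y * saw2 (1 / (x * y)) * \<phi> y\<bar> \<le> 256 * \<mu>^4 * x"
    by (simp only: J abs_mult)
  let ?h = "\<lambda>z. if z \<le> x then 1 else x / z"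
  have "\<bar>LINT z|unit_leb. \<phi> z * T z\<bar> \<le> (LINT z|unit_leb. 8 * \<bar>\<mu>\<bar> * ?h z)"
  proof (rule abs_integral_unit_leb_le)
    show "integrable unit_leb (\<lambda>z. 8 * \<bar>\<mu>\<bar> * ?h z)"
      by (intro integrable_mult_right integrable_cut_reciprocal x)
    fix z :: real assume z: "z \<in> {0..1}"
    have "\<bar>T z\<bar> \<le> 8 * ?h z" using T8[OF z] T1[of z] by simp
    then have "\<bar>\<phi> z\<bar> * \<bar>T z\<bar> \<le> \<bar>\<mu>\<bar> * (8 * ?h z)"
      using eigenfunction_abs_le[OF eig norm z] by (intro mult_mono) auto
    then show "\<bar>\<phi> z * T z\<bar> \<le> 8 * \<bar>\<mu>\<bar> * ?h z"
      by (simp only: abs_mult ac_simps)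
  qed
  also have "\<dots> = 8 * \<bar>\<mu>\<bar> * (x * (1 + ln (1 / x)))"
    by (simp only: integral_mult_right_zero integral_cut_reciprocal[OF x])
  finally have "\<bar>\<mu>\<bar> * \<bar>LINT z|unit_leb. \<phi> z * T z\<bar> \<le> \<bar>\<mu>\<bar> * (8 * \<bar>\<mu>\<bar> * (x * (1 + ln (1 / x))))"
    by (intro mult_left_mono) auto
  also have "\<dots> = 8 * \<bar>\<mu>\<bar>\<^sup>2 * x * (1 + ln (1 / x))" by (simp only: power2_eq_square ac_simps)
  also have "\<bar>\<mu>\<bar>\<^sup>2 = \<mu>\<^sup>2" by simp
  finally show "\<bar>LINT y|unit_leb. y * saw2 (1 / (x * y)) * \<phi> y\<bar> \<le> 8 * \<mu>\<^sup>2 * x * (1 + ln (1 / x))"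
    by (simp only: J abs_mult)
qed

text \<open>Pairing with the indicator of \<open>{0..x}\<close> expresses the primitive through
  \<open>G z\<close>, the integral of \<open>K t z\<close> over t from 0 to x, to which
  \<open>integrated_kernel_expansion\<close> applies. Its error, integrated against an eigenfunction
  of L^1 norm at most 1, stays below \<open>2 * x^3\<close>.\<close>

lemma eigenfunction_primitive_le_moment:
  assumes eig: "is_eigenfunction \<phi> \<mu>" and norm: "ip \<phi> \<phi> = 1" and x: "0 < x" "x \<le> 1"
  shows "\<bar>LINT y|lebesgue_on {0..x}. \<phi> y\<bar>
    \<le> \<bar>\<mu>\<bar> * (x\<^sup>2 * \<bar>LINT y|unit_leb. y * saw2 (1 / (x * y)) * \<phi> y\<bar> + 2 * x^3)"
proof -
  define G where "G z = (LINT y|unit_leb. indicator {0..x} y * K y z)" for z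
  let ?s = "\<lambda>y. y * saw2 (1 / (x * y))"
  note \<phi>m = eigenfunction_measurable[OF eig norm] and \<phi>b = eigenfunction_abs_le[OF eig norm]
  have \<phi>i: "integrable unit_leb \<phi>" by (rule integrable_unit_leb_bounded[OF \<phi>m \<phi>b])
  have ind: "indicat_real {0..x} \<in> borel_measurable unit_leb"
    by (rule borel_measurable_unit_leb) simp
  have G: "\<bar>G z + x\<^sup>2 * ?s z\<bar> \<le> 2 * x^3" if z: "z \<in> {0..1}" for z
  proof -
    have "G z = integral {0..x} (\<lambda>t. K t z)"
      unfolding G_def K_commute[of _ z]
      using integral_unit_leb_closed[OF K_integrable, of 0 x z] x by simp
    then show ?thesis using integrated_kernel_expansion[OF x, of z] z by simp
  qed
  have "(LINT y|lebesgue_on {0..x}. \<phi> y) = (LINT y|unit_leb. indicator {0..x} y * \<phi> y)"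
    using x by (auto simp: integral_restrict_space indicator_def intro!: Bochner_Integration.integral_cong)
  also have "\<dots> = \<mu> * (LINT z|unit_leb. \<phi> z * G z)"
    unfolding G_def by (rule eigenfunction_pairing[OF eig norm ind]) (simp add: indicator_def)
  finally have \<Phi>: "\<bar>LINT y|lebesgue_on {0..x}. \<phi> y\<bar> = \<bar>\<mu>\<bar> * \<bar>LINT z|unit_leb. \<phi> z * G z\<bar>"
    by (simp only: abs_mult)
  have si: "integrable unit_leb (\<lambda>z. ?s z * \<phi> z)"
  proof (rule integrable_unit_leb_bounded[where c = "1 * \<bar>\<mu>\<bar>"])
    show "(\<lambda>z. ?s z * \<phi> z) \<in> borel_measurable unit_leb"
      by (intro borel_measurable_times[OF saw2_weight_measurable \<phi>m])
    fix z :: real assume "z \<in> {0..1}"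
    then show "\<bar>?s z * \<phi> z\<bar> \<le> 1 * \<bar>\<mu>\<bar>"
      unfolding abs_mult[of "?s z"] by (intro mult_mono saw2_weight_bound \<phi>b) auto
  qed
  have Gi: "integrable unit_leb (\<lambda>z. \<phi> z * G z)"
    unfolding G_def
    by (rule integrable_eigenfunction_transform[OF eig norm ind]) (simp add: indicator_def)
  have "(LINT z|unit_leb. \<phi> z * G z) + x\<^sup>2 * (LINT z|unit_leb. ?s z * \<phi> z)
      = (LINT z|unit_leb. \<phi> z * G z + x\<^sup>2 * (?s z * \<phi> z))"
    by (simp only: Bochner_Integration.integral_add[OF Gi integrable_mult_right[OF si]] integral_mult_right_zero)
  also have "\<bar>\<dots>\<bar> \<le> (LINT z|unit_leb. 2 * x^3 * \<bar>\<phi> z\<bar>)"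
  proof (rule abs_integral_unit_leb_le)
    show "integrable unit_leb (\<lambda>z. 2 * x^3 * \<bar>\<phi> z\<bar>)" using \<phi>i by simp
    fix z :: real assume z: "z \<in> {0..1}"
    have "\<bar>\<phi> z * G z + x\<^sup>2 * (?s z * \<phi> z)\<bar> = \<bar>G z + x\<^sup>2 * ?s z\<bar> * \<bar>\<phi> z\<bar>"
      by (simp add: algebra_simps flip: abs_mult)
    also have "\<dots> \<le> 2 * x^3 * \<bar>\<phi> z\<bar>"
      by (intro mult_right_mono G z) auto
    finally show "\<bar>\<phi> z * G z + x\<^sup>2 * (?s z * \<phi> z)\<bar> \<le> 2 * x^3 * \<bar>\<phi> z\<bar>" .
  qed
  also have "\<dots> \<le> 2 * x^3 * 1"
    unfolding integral_mult_right_zero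
    using x by (intro mult_left_mono eigenfunction_integral_abs_le[OF eig norm]) auto
  finally have "\<bar>(LINT z|unit_leb. \<phi> z * G z) + x\<^sup>2 * (LINT z|unit_leb. ?s z * \<phi> z)\<bar> \<le> 2 * x^3"
    by simp
  moreover have "\<bar>x\<^sup>2 * (LINT z|unit_leb. ?s z * \<phi> z)\<bar> = x\<^sup>2 * \<bar>LINT z|unit_leb. ?s z * \<phi> z\<bar>"
    by (simp add: abs_mult)
  ultimately have "\<bar>LINT z|unit_leb. \<phi> z * G z\<bar> \<le> x\<^sup>2 * \<bar>LINT z|unit_leb. ?s z * \<phi> z\<bar> + 2 * x^3"
    by linarith
  then show ?thesis unfolding \<Phi> by (intro mult_left_mono) auto
qed

lemma eigenfunction_primitive_bound:
  assumes eig: "is_eigenfunction \<phi> \<mu>" and norm: "ip \<phi> \<phi> = 1" and x: "0 < x" "x \<le> 1"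
  shows "\<bar>LINT y|lebesgue_on {0..x}. \<phi> y\<bar>
    \<le> 258 * \<bar>\<mu>\<bar>^3 * x^3 * min (\<mu>\<^sup>2) (1 + ln (1 / x))"
proof -
  let ?J = "\<bar>LINT y|unit_leb. y * saw2 (1 / (x * y)) * \<phi> y\<bar>"
  have \<mu>: "1 \<le> \<bar>\<mu>\<bar>" by (rule eigenvalue_abs_ge[OF eig norm])
  have ln: "0 \<le> ln (1 / x)" using x by simp
  have \<mu>2: "1 \<le> \<mu>\<^sup>2" using power_mono[OF \<mu>, of 2] by simp
  have \<mu>4: "1 \<le> \<mu>^4" using power_mono[OF \<mu>, of 4] by simp
  \<comment> \<open>Here m stands for either entry of the minimum. The condition
    \<open>1 \<le> \<mu>\<^sup>2 * m\<close> lets the error \<open>2 * x^3\<close> be absorbed,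
    whence 256 + 2 = 258.\<close>
  have reduce: "\<bar>LINT y|lebesgue_on {0..x}. \<phi> y\<bar> \<le> 258 * \<bar>\<mu>\<bar>^3 * x^3 * m"
    if "?J \<le> 256 * \<mu>\<^sup>2 * x * m" "1 \<le> \<mu>\<^sup>2 * m" for m
  proof -
    have "x\<^sup>2 * ?J + 2 * x^3 \<le> x\<^sup>2 * (256 * \<mu>\<^sup>2 * x * m) + 2 * x^3 * (\<mu>\<^sup>2 * m)"
    proof (intro add_mono mult_left_mono that(1))
      show "2 * x^3 \<le> 2 * x^3 * (\<mu>\<^sup>2 * m)"
        using mult_left_mono[OF that(2), of "2 * x^3"] x by simp
    qed simp
    also have "\<dots> = 258 * \<bar>\<mu>\<bar>\<^sup>2 * x^3 * m"
      by (simp add: power2_eq_square power3_eq_cube algebra_simps)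
    finally have "\<bar>\<mu>\<bar> * (x\<^sup>2 * ?J + 2 * x^3) \<le> \<bar>\<mu>\<bar> * (258 * \<bar>\<mu>\<bar>\<^sup>2 * x^3 * m)"
      by (intro mult_left_mono) auto
    then show ?thesis
      using eigenfunction_primitive_le_moment[OF assms]
      by (simp add: power2_eq_square power3_eq_cube ac_simps)
  qed
  have "?J \<le> 256 * \<mu>\<^sup>2 * x * \<mu>\<^sup>2"
    using saw2_moment_bounds(1)[OF assms] by (simp add: power_numeral_reduce ac_simps)
  moreover have "1 \<le> \<mu>\<^sup>2 * \<mu>\<^sup>2" using \<mu>4 by (simp add: power_numeral_reduce ac_simps)
  ultimately have "\<bar>LINT y|lebesgue_on {0..x}. \<phi> y\<bar> \<le> 258 * \<bar>\<mu>\<bar>^3 * x^3 * \<mu>\<^sup>2"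
    by (rule reduce)
  moreover have "\<bar>LINT y|lebesgue_on {0..x}. \<phi> y\<bar> \<le> 258 * \<bar>\<mu>\<bar>^3 * x^3 * (1 + ln (1 / x))"
  proof (rule reduce)
    have "?J \<le> 8 * \<mu>\<^sup>2 * x * (1 + ln (1 / x))" by (rule saw2_moment_bounds(2)[OF assms])
    also have "\<dots> \<le> 256 * \<mu>\<^sup>2 * x * (1 + ln (1 / x))"
      using x ln by (intro mult_right_mono) auto
    finally show "?J \<le> 256 * \<mu>\<^sup>2 * x * (1 + ln (1 / x))" .
    show "1 \<le> \<mu>\<^sup>2 * (1 + ln (1 / x))"
      using mult_mono[OF \<mu>2, of 1 "1 + ln (1 / x)"] ln by simp
  qed
  ultimately show ?thesis by (simp only: min_def split: if_split) simp
qed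

theorem theorem5p8:
  shows "\<exists>C>0. \<forall>phi lam. eigen_system phi lam \<longrightarrow>
    (\<forall>j\<ge>1. \<forall>x\<in>{0<..1}.
       \<bar>LINT y|lebesgue_on {0..x}. phi j y\<bar>
         \<le> C * \<bar>lam j\<bar>^3 * x^3 * min ((lam j)^2) (1 + ln (1 / x)))"
proof (intro exI[of _ 258] conjI allI impI ballI)
  fix phi :: "nat \<Rightarrow> real \<Rightarrow> real" and lam :: "nat \<Rightarrow> real" and j :: nat and x :: real
  assume sys: "eigen_system phi lam" and j: "1 \<le> j" and x: "x \<in> {0<..1}"
  show "\<bar>LINT y|lebesgue_on {0..x}. phi j y\<bar>
      \<le> 258 * \<bar>lam j\<bar>^3 * x^3 * min ((lam j)^2) (1 + ln (1 / x))"
    by (rule eigenfunction_primitive_bound) (use sys j x in \<open>auto simp: eigen_system_def\<close>)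
qed simp

end
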